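(* Let $V_{\mathbb H}^R$ be a separable right quaternionic Hilbert space. For every $A\in\mathcal B(V_{\mathbb H}^R)$ and every $K\in\mathcal B_0(V_{\mathbb H}^R)$, we have $\sigma_e^S(A+K)=\sigma_e^S(A)$, $\sigma_{el}^S(A+K)=\sigma_{el}^S(A)$ and $\sigma_{er}^S(A+K)=\sigma_{er}^S(A)$.
   Context: $\mathbb H$ denotes the quaternions. A right quaternionic Hilbert space is a right $\mathbb H$-vector space, complete for the norm of an $\mathbb H$-valued inner product $\langle\cdot|\cdot\rangle$ satisfying $\overline{\langle\phi|\psi\rangle}=\langle\psi|\phi\rangle$, $\|\phi\|^2=\langle\phi|\phi\rangle>0$ for $\phi\ne0$, additivity, $\langle\phi|\psi\mathfrak q\rangle=\langle\phi|\psi\rangle\mathfrak q$ and $\langle\phi\mathfrak q|\psi\rangle=\overline{\mathfrak q}\langle\phi|\psi\rangle$. $\mathcal B(V_{\mathbb H}^R)$ is the algebra of bounded right $\mathbb H$-linear operators on $V_{\mathbb H}^R$ and $\mathcal B_0(V_{\mathbb H}^R)$ is the closed two-sided ideal of compact operators (closure of the image of the closed unit ball is compact). The Calkin algebra is the quotient unital Banach algebra $\mathcal B(V_{\mathbb H}^R)/\mathcal B_0(V_{\mathbb H}^R)$, and $\pi$ is the quotient map. For an element $a$ of a unital algebra with unit $1$ and $\mathfrak q\in\mathbb H$, put $R_{\mathfrak q}(a)=a^2-2\,\mathrm{Re}(\mathfrak q)a+|\mathfrak q|^2 1$. The $S$-spectrum $\sigma_S(a)$, left $S$-spectrum $\sigma_l^S(a)$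 and right $S$-spectrum $\sigma_r^S(a)$ are the sets of $\mathfrak q\in\mathbb H$ for which $R_{\mathfrak q}(a)$ is not invertible, not left invertible, not right invertible, respectively. In the Calkin algebra define $\sigma_e^S(A)=\sigma_S(\pi(A))$, $\sigma_{el}^S(A)=\sigma_l^S(\pi(A))$, $\sigma_{er}^S(A)=\sigma_r^S(\pi(A))$ (essential, left essential, right essential $S$-spectrum). *)

theory Defs
  imports
    "HOL-Analysis.Analysis"
    "HOL-Algebra.QuotRing"
    "HOL-Algebra.Module"
begin

section \<open>Quaternions\<close>

text \<open>\<open>Quat a b c d\<close> stands for \<open>a + b i + c j + d k\<close>.\<close>

datatype quat = Quat (qRe: real) (qI: real) (qJ: real) (qK: real)

lemma quat_eqI: "qRe p = qRe q \<Longrightarrow> qI p = qI q \<Longrightarrow> qJ p = qJ q \<Longrightarrow> qK p = qK q \<Longrightarrow> p = q"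
  by (rule quat.expand) simp

lemma quat_eq_iff: "p = q \<longleftrightarrow> qRe p = qRe q \<and> qI p = qI q \<and> qJ p = qJ q \<and> qK p = qK q"
  by (auto intro: quat_eqI)

instantiation quat :: real_algebra_1
begin

definition zero_quat where "0 = Quat 0 0 0 0"
definition one_quat where "1 = Quat 1 0 0 0"
definition plus_quat where
  "p + q = Quat (qRe p + qRe q) (qI p + qI q) (qJ p + qJ q) (qK p + qK q)"
definition uminus_quat where "- q = Quat (- qRe q) (- qI q) (- qJ q) (- qK q)"
definition minus_quat where
  "p - q = Quat (qRe p - qRe q) (qI p - qI q) (qJ p - qJ q) (qK p - qK q)"
definition times_quat where
  "p * q = Quat
     (qRe p * qRe q - qI p * qI q - qJ p * qJ q - qK p * qK q)
     (qRe p * qI q + qI p * qRe q + qJ p * qK q - qK p * qJ q)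
     (qRe p * qJ q - qI p * qK q + qJ p * qRe q + qK p * qI q)
     (qRe p * qK q + qI p * qJ q - qJ p * qI q + qK p * qRe q)"
definition scaleR_quat where "r *\<^sub>R q = Quat (r * qRe q) (r * qI q) (r * qJ q) (r * qK q)"

lemmas quat_defs = zero_quat_def one_quat_def plus_quat_def uminus_quat_def minus_quat_def
  times_quat_def scaleR_quat_def

instance
  by standard (simp_all add: quat_defs algebra_simps)

end

definition qcnj :: "quat \<Rightarrow> quat" where
  "qcnj q = Quat (qRe q) (- qI q) (- qJ q) (- qK q)"

instantiation quat :: real_normed_div_algebra
begin

definition norm_quat where "norm q = sqrt ((qRe q)\<^sup>2 + (qI q)\<^sup>2 + (qJ q)\<^sup>2 + (qK q)\<^sup>2)"
definition inverse_quat where "inverse q = qcnj q /\<^sub>R (norm q)\<^sup>2"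
definition divide_quat where "p div q = p * inverse q" for p q :: quat
definition sgn_quat where "sgn q = q /\<^sub>R norm q" for q :: quat
definition dist_quat where "dist p q = norm (p - q)" for p q :: quat
definition uniformity_quat where
  "(uniformity :: (quat \<times> quat) filter) = (INF e\<in>{0 <..}. principal {(x, y). dist x y < e})"
definition open_quat where
  "open (U :: quat set) \<longleftrightarrow> (\<forall>x\<in>U. eventually (\<lambda>(x', y). x' = x \<longrightarrow> y \<in> U) uniformity)"

lemma norm_quat_prod: "norm q = norm (qRe q, qI q, qJ q, qK q)"
  by (simp add: norm_quat_def norm_Pair add.assoc)

lemma norm_quat_power2: "(norm q)\<^sup>2 = (qRe q)\<^sup>2 + (qI q)\<^sup>2 + (qJ q)\<^sup>2 + (qK q)\<^sup>2" for q :: quat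
  by (simp add: norm_quat_def)

instance
proof
  fix a :: real and p q :: quat and U :: "quat set"
  show norm_0: "norm q = 0 \<longleftrightarrow> q = 0"
    by (auto simp: norm_quat_prod quat_eq_iff zero_quat_def zero_prod_def)
  have qcnj_mult: "qcnj q * q = (norm q)\<^sup>2 *\<^sub>R 1" "q * qcnj q = (norm q)\<^sup>2 *\<^sub>R 1"
    unfolding norm_quat_power2 by (simp_all add: qcnj_def quat_defs power2_eq_square)
  show "inverse q * q = 1" "q * inverse q = 1" if "q \<noteq> 0"
    using that by (simp_all add: inverse_quat_def qcnj_mult norm_0)
  show "p div q = p * inverse q" by (rule divide_quat_def)
  show "inverse (0::quat) = 0" by (simp add: inverse_quat_def qcnj_def quat_defs)
  show "sgn q = q /\<^sub>R norm q" by (rule sgn_quat_def)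
  show "dist p q = norm (p - q)" by (rule dist_quat_def)
  show "(uniformity :: (quat \<times> quat) filter) = (INF e\<in>{0 <..}. principal {(x, y). dist x y < e})"
    by (rule uniformity_quat_def)
  show "open U \<longleftrightarrow> (\<forall>x\<in>U. eventually (\<lambda>(x', y). x' = x \<longrightarrow> y \<in> U) uniformity)"
    by (rule open_quat_def)
  show "norm (p + q) \<le> norm p + norm q"
    using norm_triangle_ineq[of "(qRe p, qI p, qJ p, qK p)" "(qRe q, qI q, qJ q, qK q)"]
    by (simp add: norm_quat_prod plus_quat_def)
  show "norm (a *\<^sub>R q) = \<bar>a\<bar> * norm q"
    using norm_scaleR[of a "(qRe q, qI q, qJ q, qK q)"]
    by (simp add: norm_quat_prod scaleR_quat_def)
  show "norm (p * q) = norm p * norm q"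
    unfolding norm_quat_def real_sqrt_mult[symmetric]
    by (rule arg_cong[where f = sqrt])
      (simp add: times_quat_def power2_eq_square algebra_simps)
qed

end


section \<open>Right quaternionic Hilbert spaces\<close>

text \<open>
  The real vector space structure is the restriction of the quaternionic one to real scalars, and
  the norm is the one induced by the inner product; basing the class on
  \<^class>\<open>real_normed_vector\<close> (whose triangle inequality would follow from Cauchy--Schwarz)
  makes the library's topology and bounded operators available. Axiom \<open>qinner_self\<close> is an
  equation in the quaternions, so it also says that \<open>qinner x x\<close> is real; it is positive
  for \<open>x \<noteq> 0\<close> because norms are.
\<close>

class right_quat_inner = real_normed_vector +
  fixes qscale :: "'a \<Rightarrow> quat \<Rightarrow> 'a" (infixl \<open>*\<^sub>H\<close> 75)
    and qinner :: "'a \<Rightarrow> 'a \<Rightarrow> quat"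
  assumes qscale_add_left: "(x + y) *\<^sub>H q = x *\<^sub>H q + y *\<^sub>H q"
    and qscale_add_right: "x *\<^sub>H (p + q) = x *\<^sub>H p + x *\<^sub>H q"
    and qscale_qscale: "x *\<^sub>H p *\<^sub>H q = x *\<^sub>H (p * q)"
    and qscale_one: "x *\<^sub>H 1 = x"
    and qscale_of_real: "x *\<^sub>H of_real r = r *\<^sub>R x"
    and qinner_commute: "qcnj (qinner x y) = qinner y x"
    and qinner_self: "qinner x x = of_real ((norm x)\<^sup>2)"
    and qinner_add_right: "qinner x (y + z) = qinner x y + qinner x z"
    and qinner_add_left: "qinner (x + y) z = qinner x z + qinner y z"
    and qinner_qscale_right: "qinner x (y *\<^sub>H q) = qinner x y * q"
    and qinner_qscale_left: "qinner (x *\<^sub>H q) y = qcnj q * qinner x y"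

class right_quat_hilbert = right_quat_inner + complete_space


section \<open>S-spectra in a real unital algebra\<close>

text \<open>
  Unital, not necessarily commutative real algebras are represented by the record type
  \<open>module\<close> of HOL-Algebra, which provides ring operations together with scalar
  multiplication; the coefficients of \<open>R\<^sub>q(a)\<close> are real.
\<close>

definition S_poly :: "(real, 'a, 'm) module_scheme \<Rightarrow> quat \<Rightarrow> 'a \<Rightarrow> 'a" where
  "S_poly M q a = a [^]\<^bsub>M\<^esub> (2::nat) \<ominus>\<^bsub>M\<^esub> (2 * qRe q) \<odot>\<^bsub>M\<^esub> a \<oplus>\<^bsub>M\<^esub> (norm q)\<^sup>2 \<odot>\<^bsub>M\<^esub> \<one>\<^bsub>M\<^esub>"

definition left_invertible :: "('a, 'm) ring_scheme \<Rightarrow> 'a \<Rightarrow> bool" where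
  "left_invertible M a \<longleftrightarrow> (\<exists>b\<in>carrier M. b \<otimes>\<^bsub>M\<^esub> a = \<one>\<^bsub>M\<^esub>)"

definition right_invertible :: "('a, 'm) ring_scheme \<Rightarrow> 'a \<Rightarrow> bool" where
  "right_invertible M a \<longleftrightarrow> (\<exists>b\<in>carrier M. a \<otimes>\<^bsub>M\<^esub> b = \<one>\<^bsub>M\<^esub>)"

definition S_spectrum :: "(real, 'a, 'm) module_scheme \<Rightarrow> 'a \<Rightarrow> quat set" where
  "S_spectrum M a = {q. S_poly M q a \<notin> Units M}"

definition left_S_spectrum :: "(real, 'a, 'm) module_scheme \<Rightarrow> 'a \<Rightarrow> quat set" where
  "left_S_spectrum M a = {q. \<not> left_invertible M (S_poly M q a)}"

definition right_S_spectrum :: "(real, 'a, 'm) module_scheme \<Rightarrow> 'a \<Rightarrow> quat set" where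
  "right_S_spectrum M a = {q. \<not> right_invertible M (S_poly M q a)}"


section \<open>Bounded operators, compact operators and the Calkin algebra\<close>

definition bounded_ops :: "('v::right_quat_hilbert \<Rightarrow>\<^sub>L 'v) set" where
  "bounded_ops = {T. \<forall>x q. blinfun_apply T (x *\<^sub>H q) = blinfun_apply T x *\<^sub>H q}"

definition compact_ops :: "('v::right_quat_hilbert \<Rightarrow>\<^sub>L 'v) set" where
  "compact_ops = {T \<in> bounded_ops. compact (closure (blinfun_apply T ` cball 0 1))}"

definition op_algebra :: "(real, 'v::right_quat_hilbert \<Rightarrow>\<^sub>L 'v) module" where
  "op_algebra = \<lparr>carrier = bounded_ops, mult = (o\<^sub>L), one = id_blinfun,
     zero = 0, add = (+), smult = (*\<^sub>R)\<rparr>"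

text \<open>
  The quotient ring \<open>M Quot I\<close> has no scalar multiplication; it is added here in the
  same style as the library's multiplication of cosets, so that
  \<open>r \<odot> (I +> a) = I +> (r \<odot> a)\<close>.
\<close>

definition quotient_algebra :: "(real, 'a, 'm) module_scheme \<Rightarrow> 'a set \<Rightarrow> (real, 'a set) module" where
  "quotient_algebra M I = ring.extend (M Quot I)
     (module.fields (\<lambda>r X. \<Union>a\<in>X. I +>\<^bsub>M\<^esub> (r \<odot>\<^bsub>M\<^esub> a)))"

definition calkin_algebra :: "(real, ('v::right_quat_hilbert \<Rightarrow>\<^sub>L 'v) set) module" where
  "calkin_algebra = quotient_algebra op_algebra compact_ops"

definition calkin_proj :: "('v::right_quat_hilbert \<Rightarrow>\<^sub>L 'v) \<Rightarrow> ('v \<Rightarrow>\<^sub>L 'v) set" where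
  "calkin_proj A = compact_ops +>\<^bsub>op_algebra\<^esub> A"

definition essential_S_spectrum :: "('v::right_quat_hilbert \<Rightarrow>\<^sub>L 'v) \<Rightarrow> quat set" where
  "essential_S_spectrum A = S_spectrum calkin_algebra (calkin_proj A)"

definition left_essential_S_spectrum :: "('v::right_quat_hilbert \<Rightarrow>\<^sub>L 'v) \<Rightarrow> quat set" where
  "left_essential_S_spectrum A = left_S_spectrum calkin_algebra (calkin_proj A)"

definition right_essential_S_spectrum :: "('v::right_quat_hilbert \<Rightarrow>\<^sub>L 'v) \<Rightarrow> quat set" where
  "right_essential_S_spectrum A = right_S_spectrum calkin_algebra (calkin_proj A)"

end

theory Submission
  imports Defs
begin

text \<open>
  All three essential spectra of \<open>A\<close> are computed from the class of \<open>A\<close> in the Calkin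
  algebra, so it is enough that \<open>A + K\<close> and \<open>A\<close> have the same class. As the class is the
  coset of \<open>A\<close> modulo the compact operators, this only requires that the compact operators form
  an additive group: translation by \<open>K\<close> is then a bijection of \<open>compact_ops\<close> onto itself.
  Closure under sums and differences holds because the image of the unit ball under \<open>S + T\<close> or
  \<open>S - T\<close> lies in the Minkowski sum or difference of two compact sets, which is compact as a
  continuous image of their product.
\<close>

lemma qscale_diff_left: "(x - y) *\<^sub>H q = x *\<^sub>H q - y *\<^sub>H q"
  for x y :: "'v::right_quat_inner"
  by (metis add_diff_cancel_right' diff_add_cancel qscale_add_left)

lemma bounded_ops_add: "S \<in> bounded_ops \<Longrightarrow> T \<in> bounded_ops \<Longrightarrow> S + T \<in> bounded_ops"
  by (simp add: bounded_ops_def blinfun.add_left qscale_add_left)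

lemma bounded_ops_diff: "S \<in> bounded_ops \<Longrightarrow> T \<in> bounded_ops \<Longrightarrow> S - T \<in> bounded_ops"
  by (simp add: bounded_ops_def blinfun.diff_left qscale_diff_left)

lemma compact_closure_of_subset:
  fixes X C :: "'a::t2_space set"
  assumes "compact C" "X \<subseteq> C"
  shows "compact (closure X)"
proof -
  have "closure X \<subseteq> C"
    using assms by (simp add: closure_minimal compact_imp_closed)
  then show ?thesis
    using compact_Int_closed[OF assms(1), of "closure X"] by (simp add: Int_absorb1)
qed

lemma compact_ops_add:
  assumes S: "S \<in> compact_ops" and T: "T \<in> compact_ops"
  shows "S + T \<in> compact_ops"
proof -
  let ?B = "cball 0 1"
  let ?C = "{x + y |x y. x \<in> closure (blinfun_apply S ` ?B) \<and> y \<in> closure (blinfun_apply T ` ?B)}"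
  have "compact ?C"
    using S T by (intro compact_sums) (simp_all add: compact_ops_def)
  moreover have "blinfun_apply (S + T) ` ?B \<subseteq> ?C"
  proof
    fix z assume "z \<in> blinfun_apply (S + T) ` ?B"
    then obtain x where x: "x \<in> ?B" "z = blinfun_apply S x + blinfun_apply T x"
      by (auto simp: blinfun.add_left)
    have "blinfun_apply S x \<in> closure (blinfun_apply S ` ?B)"
      "blinfun_apply T x \<in> closure (blinfun_apply T ` ?B)"
      by (rule subsetD[OF closure_subset], rule imageI, rule x(1))+
    then show "z \<in> ?C"
      using x(2) by blast
  qed
  ultimately have "compact (closure (blinfun_apply (S + T) ` ?B))"
    by (rule compact_closure_of_subset)
  then show ?thesis
    using S T by (simp add: compact_ops_def bounded_ops_add)
qed

lemma compact_ops_diff: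
  assumes S: "S \<in> compact_ops" and T: "T \<in> compact_ops"
  shows "S - T \<in> compact_ops"
proof -
  let ?B = "cball 0 1"
  let ?C = "{x - y |x y. x \<in> closure (blinfun_apply S ` ?B) \<and> y \<in> closure (blinfun_apply T ` ?B)}"
  have "compact ?C"
    using S T by (intro compact_differences) (simp_all add: compact_ops_def)
  moreover have "blinfun_apply (S - T) ` ?B \<subseteq> ?C"
  proof
    fix z assume "z \<in> blinfun_apply (S - T) ` ?B"
    then obtain x where x: "x \<in> ?B" "z = blinfun_apply S x - blinfun_apply T x"
      by (auto simp: blinfun.diff_left)
    have "blinfun_apply S x \<in> closure (blinfun_apply S ` ?B)"
      "blinfun_apply T x \<in> closure (blinfun_apply T ` ?B)"
      by (rule subsetD[OF closure_subset], rule imageI, rule x(1))+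
    then show "z \<in> ?C"
      using x(2) by blast
  qed
  ultimately have "compact (closure (blinfun_apply (S - T) ` ?B))"
    by (rule compact_closure_of_subset)
  then show ?thesis
    using S T by (simp add: compact_ops_def bounded_ops_diff)
qed

lemma calkin_proj_eq: "calkin_proj A = {H + A |H. H \<in> compact_ops}"
  by (auto simp: calkin_proj_def a_r_coset_def r_coset_def op_algebra_def)

text \<open>
  An element \<open>H + (A + K)\<close> of the first coset is \<open>(H + K) + A\<close>, and an element
  \<open>H + A\<close> of the second one is \<open>(H - K) + (A + K)\<close>.
\<close>

lemma calkin_proj_add_compact:
  assumes "K \<in> compact_ops"
  shows "calkin_proj (A + K) = calkin_proj A"
proof
  show "calkin_proj (A + K) \<subseteq> calkin_proj A"
  proof
    fix X assume "X \<in> calkin_proj (A + K)"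
    then obtain H where "H \<in> compact_ops" "X = (H + K) + A"
      by (auto simp: calkin_proj_eq algebra_simps)
    then show "X \<in> calkin_proj A"
      using compact_ops_add[OF _ assms] by (auto simp: calkin_proj_eq)
  qed
  show "calkin_proj A \<subseteq> calkin_proj (A + K)"
  proof
    fix X assume "X \<in> calkin_proj A"
    then obtain H where "H \<in> compact_ops" "X = (H - K) + (A + K)"
      by (auto simp: calkin_proj_eq)
    then show "X \<in> calkin_proj (A + K)"
      using compact_ops_diff[OF _ assms] unfolding calkin_proj_eq by blast
  qed
qed

theorem proposition7p15:
  fixes A K :: "'v::right_quat_hilbert \<Rightarrow>\<^sub>L 'v"
  assumes "separable_space (euclidean :: 'v topology)"
    and "A \<in> bounded_ops"
    and "K \<in> compact_ops"
  shows "essential_S_spectrum (A + K) = essential_S_spectrum A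
    \<and> left_essential_S_spectrum (A + K) = left_essential_S_spectrum A
    \<and> right_essential_S_spectrum (A + K) = right_essential_S_spectrum A"
  using calkin_proj_add_compact[OF assms(3), of A]
  by (simp add: essential_S_spectrum_def left_essential_S_spectrum_def
      right_essential_S_spectrum_def)

end
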